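(* There do not exist $\mathbb{Z}_2R$ linear self-dual codes of Type $0$. That is, for all $\alpha,\beta$, every $\mathbb{Z}_2R$ linear self-dual code $\mathcal{C}\subseteq\mathbb{Z}_2^\alpha\times R^\beta$ has no codeword of odd Lee weight.
   Context: Let $R=\mathbb{Z}_2+u\mathbb{Z}_2=\{0,1,u,1+u\}$ with $u^2=0$, and $\eta:R\to\mathbb{Z}_2$, $\eta(r+uq)=r$. The set $\mathbb{Z}_2^\alpha\times R^\beta$ is an $R$-module under $d(a_1,\dots,a_\alpha\mid b_1,\dots,b_\beta)=(\eta(d)a_1,\dots,\eta(d)a_\alpha\mid db_1,\dots,db_\beta)$. A $\mathbb{Z}_2R$ linear code is an $R$-submodule $\mathcal{C}$ of $\mathbb{Z}_2^\alpha\times R^\beta$. The inner product is $\langle(\mathbf v|\mathbf w),(\mathbf x|\mathbf y)\rangle=u\sum_{i=1}^\alpha v_ix_i+\sum_{j=1}^\beta w_jy_j\in R$; $\mathcal{C}^\perp$ is the set of vectors orthogonal to all of $\mathcal{C}$; $\mathcal{C}$ is self-dual if $\mathcal{C}=\mathcal{C}^\perp$. The Lee weight on $R$ is $wt_L(0)=0$, $wt_L(1)=wt_L(1+u)=1$, $wt_L(u)=2$, extended additively to $R^\beta$, and $wt_L(\mathbf v|\mathbf w)=wt_H(\mathbf v)+wt_L(\mathbf w)$, where $wt_H$ is the Hamming weight. A self-dual code is of Type $0$ if it has codewords of odd Lee weight. *)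

theory Defs
  imports "HOL-Library.Z2" "Jordan_Normal_Form.Matrix"
begin

text \<open>\<open>R_elem r q\<close> represents \<open>r + u q\<close>, so that the selector \<open>eta\<close> is the
  reduction map \<open>R \<rightarrow> \<int>\<^sub>2\<close>.\<close>

datatype R = R_elem (eta: bit) (ucoeff: bit)

instantiation R :: comm_ring_1
begin

definition zero_R :: R where "0 = R_elem 0 0"
definition one_R :: R where "1 = R_elem 1 0"
definition plus_R :: "R \<Rightarrow> R \<Rightarrow> R" where
  "x + y = R_elem (eta x + eta y) (ucoeff x + ucoeff y)"
definition uminus_R :: "R \<Rightarrow> R" where
  "- x = R_elem (- eta x) (- ucoeff x)"
definition minus_R :: "R \<Rightarrow> R \<Rightarrow> R" where
  "x - y = R_elem (eta x - eta y) (ucoeff x - ucoeff y)"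
definition times_R :: "R \<Rightarrow> R \<Rightarrow> R" where
  "x * y = R_elem (eta x * eta y) (eta x * ucoeff y + ucoeff x * eta y)"

instance
  by standard
    (simp_all only: zero_R_def one_R_def plus_R_def uminus_R_def minus_R_def times_R_def
      R.sel R.inject R.collapse ac_simps distrib_left distrib_right add_0_left add_0_right
      mult_1_left mult_zero_left right_minus diff_conv_add_uminus zero_neq_one simp_thms)

end

definition u :: R where "u = R_elem 0 1"

definition of_Z2 :: "bit \<Rightarrow> R" where "of_Z2 r = R_elem r 0"

lemma R_elem_eq: "R_elem r q = of_Z2 r + u * of_Z2 q"
  by (simp add: of_Z2_def u_def plus_R_def times_R_def)

lemma u_squared: "u * u = 0"
  by (simp add: u_def times_R_def zero_R_def)

lemma UNIV_R: "(UNIV :: R set) = {0, 1, u, 1 + u}"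
proof -
  have "x \<in> {0, 1, u, 1 + u}" for x :: R
    by (cases x; cases "eta x"; cases "ucoeff x")
      (auto simp: zero_R_def one_R_def u_def plus_R_def)
  then show ?thesis by blast
qed

type_synonym Z2R_vec = "bit vec \<times> R vec"

text \<open>The multiplicative fields \<open>mult\<close> and \<open>one\<close> play no role in a module.\<close>

definition Z2R_module :: "nat \<Rightarrow> nat \<Rightarrow> (R, Z2R_vec) module" where
  "Z2R_module \<alpha> \<beta> =
    \<lparr>carrier = carrier_vec \<alpha> \<times> carrier_vec \<beta>,
     mult = undefined,
     one = undefined,
     zero = (0\<^sub>v \<alpha>, 0\<^sub>v \<beta>),
     add = (\<lambda>(v, w) (x, y). (v + x, w + y)),
     module.smult = (\<lambda>d (v, w). (eta d \<cdot>\<^sub>v v, d \<cdot>\<^sub>v w))\<rparr>"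

definition R_ring :: "R ring" where
  "R_ring = \<lparr>carrier = UNIV, mult = (*), one = 1, zero = 0, add = (+)\<rparr>"

lemma cring_R_ring: "cring R_ring"
proof -
  have "\<exists>y. y + x = 0" for x :: R
    using left_minus by blast
  then show ?thesis
    by (intro cringI abelian_groupI comm_monoidI) (auto simp: R_ring_def algebra_simps)
qed

lemma eta_simps: "eta 1 = 1" "eta (x + y) = eta x + eta y" "eta (x * y) = eta x * eta y"
  by (simp_all add: one_R_def plus_R_def times_R_def)

lemma module_Z2R: "module R_ring (Z2R_module \<alpha> \<beta>)"
proof (rule moduleI)
  show "cring R_ring" by (rule cring_R_ring)
  show "abelian_group (Z2R_module \<alpha> \<beta>)"
  proof (rule abelian_groupI)
    fix x assume x: "x \<in> carrier (Z2R_module \<alpha> \<beta>)"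
    obtain v w where vw: "x = (v, w)" by (cases x)
    show "\<exists>y\<in>carrier (Z2R_module \<alpha> \<beta>). y \<oplus>\<^bsub>Z2R_module \<alpha> \<beta>\<^esub> x = \<zero>\<^bsub>Z2R_module \<alpha> \<beta>\<^esub>"
      by (rule bexI[of _ "(- v, - w)"]) (use x vw in \<open>auto simp: Z2R_module_def\<close>)
  next
    fix x y assume "x \<in> carrier (Z2R_module \<alpha> \<beta>)" "y \<in> carrier (Z2R_module \<alpha> \<beta>)"
    then show "x \<oplus>\<^bsub>Z2R_module \<alpha> \<beta>\<^esub> y = y \<oplus>\<^bsub>Z2R_module \<alpha> \<beta>\<^esub> x"
      by (auto simp: Z2R_module_def intro: comm_add_vec)
  next
    fix x y z assume "x \<in> carrier (Z2R_module \<alpha> \<beta>)" "y \<in> carrier (Z2R_module \<alpha> \<beta>)"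
      "z \<in> carrier (Z2R_module \<alpha> \<beta>)"
    then show "x \<oplus>\<^bsub>Z2R_module \<alpha> \<beta>\<^esub> y \<oplus>\<^bsub>Z2R_module \<alpha> \<beta>\<^esub> z =
        x \<oplus>\<^bsub>Z2R_module \<alpha> \<beta>\<^esub> (y \<oplus>\<^bsub>Z2R_module \<alpha> \<beta>\<^esub> z)"
      by (auto simp: Z2R_module_def intro: assoc_add_vec)
  qed (auto simp: Z2R_module_def)
qed (auto simp: Z2R_module_def R_ring_def eta_simps smult_smult_assoc
      smult_add_distrib_vec add_smult_distrib_vec)

definition Z2R_linear_code :: "nat \<Rightarrow> nat \<Rightarrow> Z2R_vec set \<Rightarrow> bool" where
  "Z2R_linear_code \<alpha> \<beta> C \<longleftrightarrow> submodule C R_ring (Z2R_module \<alpha> \<beta>)"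

text \<open>\<open>v \<bullet> x\<close> is computed in \<open>\<int>\<^sub>2\<close> and then lifted to \<open>R\<close>; since \<open>of_Z2\<close> is additive and
  multiplicative, lifting the entries first gives the same value.\<close>

definition Z2R_inner :: "Z2R_vec \<Rightarrow> Z2R_vec \<Rightarrow> R" where
  "Z2R_inner = (\<lambda>(v, w) (x, y). u * of_Z2 (v \<bullet> x) + w \<bullet> y)"

definition Z2R_dual :: "nat \<Rightarrow> nat \<Rightarrow> Z2R_vec set \<Rightarrow> Z2R_vec set" where
  "Z2R_dual \<alpha> \<beta> C = {x \<in> carrier (Z2R_module \<alpha> \<beta>). \<forall>c\<in>C. Z2R_inner c x = 0}"

definition Z2R_self_dual :: "nat \<Rightarrow> nat \<Rightarrow> Z2R_vec set \<Rightarrow> bool" where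
  "Z2R_self_dual \<alpha> \<beta> C \<longleftrightarrow> C = Z2R_dual \<alpha> \<beta> C"

definition hamming_weight :: "bit vec \<Rightarrow> nat" where
  "hamming_weight v = card {i. i < dim_vec v \<and> v $ i \<noteq> 0}"

definition lee_weight_R :: "R \<Rightarrow> nat" where
  "lee_weight_R r = (if r = 0 then 0 else if r = u then 2 else 1)"

lemma lee_weight_R_simps:
  "lee_weight_R 0 = 0" "lee_weight_R 1 = 1" "lee_weight_R (1 + u) = 1" "lee_weight_R u = 2"
  by (simp_all add: lee_weight_R_def zero_R_def one_R_def u_def plus_R_def)

definition lee_weight :: "Z2R_vec \<Rightarrow> nat" where
  "lee_weight = (\<lambda>(v, w). hamming_weight v + (\<Sum>j<dim_vec w. lee_weight_R (w $ j)))"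

definition Z2R_type_0 :: "nat \<Rightarrow> nat \<Rightarrow> Z2R_vec set \<Rightarrow> bool" where
  "Z2R_type_0 \<alpha> \<beta> C \<longleftrightarrow>
    Z2R_linear_code \<alpha> \<beta> C \<and> Z2R_self_dual \<alpha> \<beta> C \<and> (\<exists>c\<in>C. odd (lee_weight c))"

end

theory Submission
  imports Defs
begin

text \<open>The Lee weight of \<open>c\<close> modulo 2 is the sum of the two coordinates of \<open>\<langle>c, c\<rangle>\<close>: the
  \<open>u\<close>-coordinate counts the nonzero binary entries, because squares in \<open>R\<close> have no \<open>u\<close>-part, and
  the other coordinate counts the units among the entries in \<open>R\<close>. Codewords of a self-dual code
  are orthogonal to themselves.\<close>

lemma eta_sum: "eta (sum f A) = (\<Sum>x\<in>A. eta (f x))"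
  by (induction A rule: infinite_finite_induct) (simp_all add: zero_R_def plus_R_def)

lemma ucoeff_sum: "ucoeff (sum f A) = (\<Sum>x\<in>A. ucoeff (f x))"
  by (induction A rule: infinite_finite_induct) (simp_all add: zero_R_def plus_R_def)

lemma eta_square: "eta (r * r) = eta r"
  by (cases "eta r") (simp_all add: times_R_def)

text \<open>The cross term \<open>eta r * ucoeff r\<close> occurs twice and cancels in
  characteristic 2.\<close>

lemma ucoeff_square: "ucoeff (r * r) = 0"
  by (auto simp: times_R_def)

text \<open>The elements of odd weight are the units \<open>1\<close> and
  \<open>1 + u\<close>.\<close>

lemma of_nat_lee_weight_R: "of_nat (lee_weight_R r) = eta r"
  by (cases r; cases "eta r"; cases "ucoeff r")
    (auto simp: lee_weight_R_def zero_R_def u_def)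

lemma of_nat_hamming_weight: "of_nat (hamming_weight v) = v \<bullet> v"
proof -
  \<comment> \<open>A bit is its own square, so each product is an indicator.\<close>
  have "v \<bullet> v = (\<Sum>i\<in>{0..<dim_vec v}. if v $ i \<noteq> 0 then 1 else 0)"
    unfolding scalar_prod_def by (rule sum.cong) auto
  also have "\<dots> = of_nat (card {i \<in> {0..<dim_vec v}. v $ i \<noteq> 0})"
    by (simp add: sum.If_cases Int_def)
  finally show ?thesis
    by (simp add: hamming_weight_def)
qed

lemma of_nat_lee_weight:
  "of_nat (lee_weight c) = eta (Z2R_inner c c) + ucoeff (Z2R_inner c c)"
proof -
  obtain v w where c: "c = (v, w)" by (cases c)
  have "of_nat (lee_weight c) = v \<bullet> v + (\<Sum>j<dim_vec w. eta (w $ j))"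
    by (simp add: c lee_weight_def of_nat_hamming_weight of_nat_lee_weight_R)
  moreover have "eta (w \<bullet> w) = (\<Sum>j<dim_vec w. eta (w $ j))"
    by (simp add: scalar_prod_def eta_sum eta_square atLeast0LessThan)
  moreover have "ucoeff (w \<bullet> w) = 0"
    by (simp add: scalar_prod_def ucoeff_sum ucoeff_square)
  \<comment> \<open>Here \<open>Z2R_inner c c\<close> is
    \<open>R_elem (eta (w \<bullet> w)) (v \<bullet> v)\<close>.\<close>
  ultimately show ?thesis
    by (cases "v \<bullet> v"; cases "eta (w \<bullet> w)")
      (simp_all add: c Z2R_inner_def plus_R_def times_R_def u_def of_Z2_def)
qed

lemma even_lee_weight_if_self_orthogonal:
  assumes "Z2R_inner c c = 0"
  shows "even (lee_weight c)"
proof -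
  have "of_nat (lee_weight c) = (0 :: bit)"
    by (simp add: of_nat_lee_weight assms zero_R_def)
  then show ?thesis
    \<comment> \<open>An odd number \<open>2 * k + 1\<close> would map to \<open>1\<close>, as
      \<open>2 = 0\<close> in \<open>bit\<close>.\<close>
    by (cases "even (lee_weight c)") (auto elim!: oddE)
qed

theorem theorem2p13:
  shows "\<not> (\<exists>(\<alpha>::nat) (\<beta>::nat) (C :: Z2R_vec set). Z2R_type_0 \<alpha> \<beta> C)"
proof -
  have "even (lee_weight c)" if "Z2R_self_dual \<alpha> \<beta> C" "c \<in> C" for \<alpha> \<beta> C c
    using that even_lee_weight_if_self_orthogonal
    unfolding Z2R_self_dual_def Z2R_dual_def by blast
  then show ?thesis
    unfolding Z2R_type_0_def by blast
qed

end
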